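(* Let $B$ be a left semi-brace. Then $B^{(n)}$ is an ideal of $B$ for every positive integer $n$.
   Context: A left semi-brace is a set $B$ with two operations $+$ and $\circ$ such that $(B,+)$ is a left cancellative semigroup (not necessarily commutative), $(B,\circ)$ is a group, and $a\circ(b+c)=a\circ b+a\circ(a^-+c)$ for all $a,b,c\in B$, where $a^-$ is the inverse of $a$ in $(B,\circ)$ and $\circ$ has higher precedence than $+$. The identity of $(B,\circ)$ is denoted $0$; it is an idempotent and a left identity of $(B,+)$. Let $E$ be the set of idempotents of $(B,+)$ and $G=B+0=\{b+0: b\in B\}$, which is a subgroup of $(B,+)$ (with identity $0$). For $a,b\in B$ put $\lambda_a(b)=a\circ(a^-+b)$, $\rho_b(a)=(a^-+b)^-\circ b$, and define the operation $a\cdot b=\lambda_a(a^-)+a\circ b+\lambda_b(b^-)$; one has $a\cdot b\in G$. For subsets $X,Y\subseteq B$, $X\cdot Y$ denotes the subgroup of $(G,+)$ generated by all $x\cdot y$ with $x\in X$, $y\in Y$, and $X+Y=\{x+y:x\in X,y\in Y\}$. The right series of $B$ is defined by $B^{(1)}=B$ and $B^{(n+1)}=B^{(n)}\cdot B+E$ for every positive integer $n$. A subsemigroup $I$ of $(B,+)$ is an ideal of $B$ if: (i) $I$ is a normal subgroup of $(B,\circ)$; (ii) $I\cap G$ is a normal subgroup of $(G,+)$; (iii) $\rho_b(n)\in I$ for all $b\in B$, $n\in I\cap G$; (iv) $\lambda_g(e)\in I$ for all $g\in G$, $e\in I\cap E$. *)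

theory Defs
  imports "HOL-Algebra.Generated_Groups"
begin

text \<open>
  The monoid part of the record carries the circle operation, so \<open>\<otimes>\<close>, \<open>\<one>\<close> and \<open>inv\<close> refer
  to the group \<open>(B, \<circ>)\<close>. In particular \<open>\<one>\<close> is the element that is usually written 0.
  The additive operation is \<open>\<boxplus>\<close>.
\<close>

record 'a semi_brace = "'a monoid" +
  sadd :: "'a \<Rightarrow> 'a \<Rightarrow> 'a"  (infixl \<open>\<boxplus>\<index>\<close> 65)

locale left_semi_brace = group B for B (structure) +
  assumes sadd_closed: "\<lbrakk>a \<in> carrier B; b \<in> carrier B\<rbrakk> \<Longrightarrow> a \<boxplus> b \<in> carrier B"
    and sadd_assoc: "\<lbrakk>a \<in> carrier B; b \<in> carrier B; c \<in> carrier B\<rbrakk>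
          \<Longrightarrow> (a \<boxplus> b) \<boxplus> c = a \<boxplus> (b \<boxplus> c)"
    and sadd_left_cancel: "\<lbrakk>a \<in> carrier B; b \<in> carrier B; c \<in> carrier B; a \<boxplus> b = a \<boxplus> c\<rbrakk>
          \<Longrightarrow> b = c"
    and left_compat: "\<lbrakk>a \<in> carrier B; b \<in> carrier B; c \<in> carrier B\<rbrakk>
          \<Longrightarrow> a \<otimes> (b \<boxplus> c) = (a \<otimes> b) \<boxplus> (a \<otimes> (inv a \<boxplus> c))"

definition sb_idem :: "('a, 'b) semi_brace_scheme \<Rightarrow> 'a set"
  where "sb_idem B = {e \<in> carrier B. e \<boxplus>\<^bsub>B\<^esub> e = e}"

definition sb_grp :: "('a, 'b) semi_brace_scheme \<Rightarrow> 'a set"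
  where "sb_grp B = {b \<boxplus>\<^bsub>B\<^esub> \<one>\<^bsub>B\<^esub> | b. b \<in> carrier B}"

text \<open>The group \<open>(G, +)\<close>; its identity is again the identity of \<open>(B, \<circ>)\<close>.\<close>

definition sb_add_group :: "('a, 'b) semi_brace_scheme \<Rightarrow> 'a monoid"
  where "sb_add_group B = \<lparr>carrier = sb_grp B, mult = sadd B, one = \<one>\<^bsub>B\<^esub>\<rparr>"

definition sb_lambda :: "('a, 'b) semi_brace_scheme \<Rightarrow> 'a \<Rightarrow> 'a \<Rightarrow> 'a"
  where "sb_lambda B a b = a \<otimes>\<^bsub>B\<^esub> (inv\<^bsub>B\<^esub> a \<boxplus>\<^bsub>B\<^esub> b)"

text \<open>\<open>sb_rho B b a\<close> is \<open>\<rho>\<^sub>b(a)\<close>: the subscript comes first.\<close>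

definition sb_rho :: "('a, 'b) semi_brace_scheme \<Rightarrow> 'a \<Rightarrow> 'a \<Rightarrow> 'a"
  where "sb_rho B b a = inv\<^bsub>B\<^esub> (inv\<^bsub>B\<^esub> a \<boxplus>\<^bsub>B\<^esub> b) \<otimes>\<^bsub>B\<^esub> b"

definition sb_dot :: "('a, 'b) semi_brace_scheme \<Rightarrow> 'a \<Rightarrow> 'a \<Rightarrow> 'a"
  where "sb_dot B a b =
    sb_lambda B a (inv\<^bsub>B\<^esub> a) \<boxplus>\<^bsub>B\<^esub> (a \<otimes>\<^bsub>B\<^esub> b) \<boxplus>\<^bsub>B\<^esub> sb_lambda B b (inv\<^bsub>B\<^esub> b)"

definition sb_set_dot :: "('a, 'b) semi_brace_scheme \<Rightarrow> 'a set \<Rightarrow> 'a set \<Rightarrow> 'a set"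
  where "sb_set_dot B X Y = generate (sb_add_group B) {sb_dot B x y | x y. x \<in> X \<and> y \<in> Y}"

definition sb_set_add :: "('a, 'b) semi_brace_scheme \<Rightarrow> 'a set \<Rightarrow> 'a set \<Rightarrow> 'a set"
  where "sb_set_add B X Y = {x \<boxplus>\<^bsub>B\<^esub> y | x y. x \<in> X \<and> y \<in> Y}"

text \<open>The right series starts at index 1; its value at index 0 is a dummy.\<close>

fun right_series :: "('a, 'b) semi_brace_scheme \<Rightarrow> nat \<Rightarrow> 'a set"
  where
    "right_series B 0 = carrier B"
  | "right_series B (Suc 0) = carrier B"
  | "right_series B (Suc (Suc n)) =
       sb_set_add B (sb_set_dot B (right_series B (Suc n)) (carrier B)) (sb_idem B)"

definition sb_ideal :: "'a set \<Rightarrow> ('a, 'b) semi_brace_scheme \<Rightarrow> bool"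
  where "sb_ideal I B \<longleftrightarrow>
    I \<subseteq> carrier B \<and>
    (\<forall>x\<in>I. \<forall>y\<in>I. x \<boxplus>\<^bsub>B\<^esub> y \<in> I) \<and>
    I \<lhd> B \<and>
    (I \<inter> sb_grp B) \<lhd> sb_add_group B \<and>
    (\<forall>b\<in>carrier B. \<forall>n\<in>I \<inter> sb_grp B. sb_rho B b n \<in> I) \<and>
    (\<forall>g\<in>sb_grp B. \<forall>e\<in>I \<inter> sb_idem B. sb_lambda B g e \<in> I)"

end

theory Submission
  imports Defs
begin

text \<open>
  Write \<open>G = B + 0\<close> and \<open>E\<close> for the set of idempotents. In a left semi-brace every idempotent is
  a left identity of \<open>+\<close> and every equation \<open>a + x = y\<close> is solvable, so \<open>(B, +)\<close> is a right group:
  \<open>\<pi>(x) = x + 0\<close> is a homomorphism from \<open>(B, +)\<close> onto the group \<open>(G, +)\<close>, each \<open>x\<close> has the form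
  \<open>\<pi>(x) + e\<close> with \<open>e \<in> E\<close>, and consequently \<open>H + E = \<pi>\<^sup>-\<^sup>1(H)\<close> for all \<open>H \<subseteq> G\<close>.

  The maps \<open>\<lambda>\<^sub>a\<close> are additive and preserve \<open>E\<close>, so \<open>\<mu>\<^sub>a(g) = \<pi>(\<lambda>\<^sub>a(g))\<close> defines an action of
  \<open>(B, \<circ>)\<close> on \<open>(G, +)\<close> by automorphisms. In these terms
  \<open>\<pi>(a \<circ> b) = \<pi>(a) + \<mu>\<^sub>a(\<pi>(b))\<close> and \<open>a \<cdot> b = \<mu>\<^sub>a(\<pi>(b)) - \<pi>(b)\<close>,
  so the computations take place in \<open>G\<close>, as for skew braces.

  A set \<open>\<pi>\<^sup>-\<^sup>1(H)\<close> is an ideal as soon as \<open>H\<close> is a normal subgroup of \<open>G\<close> that is invariant under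
  \<open>\<mu>\<close> and contains \<open>\<mu>\<^sub>x(g) - g\<close> for all \<open>g \<in> G\<close> and \<open>x \<in> \<pi>\<^sup>-\<^sup>1(H)\<close>
  (lemma \<open>sb_ideal_vimage_proj\<close>). If \<open>I\<close> is normal in \<open>(B, \<circ>)\<close>, then \<open>H = I \<cdot> B\<close> is normal in
  \<open>G\<close>, because \<open>g + a \<cdot> k - g = -(a \<cdot> g) + a \<cdot> (g + k)\<close>, and invariant, because
  \<open>\<mu>\<^sub>b(a \<cdot> g) = (b \<circ> a \<circ> b\<^sup>-) \<cdot> \<mu>\<^sub>b(g)\<close>. The last condition holds when
  \<open>I \<cdot> B + E \<subseteq> I\<close>, and the right series is decreasing because \<open>X \<cdot> B\<close> is monotone in \<open>X\<close>.
\<close>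

section \<open>The additive structure of a left semi-brace\<close>

context left_semi_brace
begin

text \<open>The projection \<open>\<pi>\<close> of \<open>B\<close> onto \<open>G\<close>; its fixed points are exactly the elements of \<open>G\<close>.\<close>

definition proj :: "'a \<Rightarrow> 'a"
  where "proj x = x \<boxplus> \<one>"

text \<open>
  The action \<open>\<mu>\<close> of \<open>(B, \<circ>)\<close> on \<open>(G, +)\<close>. The projection is needed because \<open>\<lambda>\<^sub>a\<close> need not
  map \<open>G\<close> into itself when \<open>a\<close> is outside \<open>G\<close>.
\<close>

definition act :: "'a \<Rightarrow> 'a \<Rightarrow> 'a"
  where "act a g = proj (sb_lambda B a g)"

declare sadd_closed [simp]

lemma sadd_one_left [simp]:
  assumes "c \<in> carrier B" shows "\<one> \<boxplus> c = c"
proof -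
  have "\<one> \<boxplus> (\<one> \<boxplus> c) = \<one> \<boxplus> c"
    using left_compat[of \<one> \<one> c] assms by simp
  then show ?thesis
    using sadd_left_cancel[of \<one> "\<one> \<boxplus> c" c] assms by simp
qed

lemma sb_lambda_closed [simp]:
  "a \<in> carrier B \<Longrightarrow> b \<in> carrier B \<Longrightarrow> sb_lambda B a b \<in> carrier B"
  by (simp add: sb_lambda_def)

lemma mult_eq_sadd_lambda:
  assumes "a \<in> carrier B" "b \<in> carrier B"
  shows "a \<otimes> b = a \<boxplus> sb_lambda B a b"
  using left_compat[of a \<one> b] assms by (simp add: sb_lambda_def)

lemma sb_lambda_sadd:
  assumes "a \<in> carrier B" "b \<in> carrier B" "c \<in> carrier B"
  shows "sb_lambda B a (b \<boxplus> c) = sb_lambda B a b \<boxplus> sb_lambda B a c"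
  using left_compat[of a "inv a \<boxplus> b" c] assms by (simp add: sb_lambda_def sadd_assoc)

lemma sb_lambda_mult:
  assumes "a \<in> carrier B" "b \<in> carrier B" "c \<in> carrier B"
  shows "sb_lambda B (a \<otimes> b) c = sb_lambda B a (sb_lambda B b c)"
proof -
  have "b \<otimes> (inv (a \<otimes> b) \<boxplus> c) = (b \<otimes> (inv b \<otimes> inv a)) \<boxplus> b \<otimes> (inv b \<boxplus> c)"
    using left_compat[of b "inv (a \<otimes> b)" c] assms by (simp add: inv_mult_group)
  also have "b \<otimes> (inv b \<otimes> inv a) = inv a"
    using assms by (simp add: m_assoc[symmetric])
  finally show ?thesis
    using assms by (simp add: sb_lambda_def m_assoc)
qed

lemma sb_lambda_one [simp]: "c \<in> carrier B \<Longrightarrow> sb_lambda B \<one> c = c"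
  by (simp add: sb_lambda_def)

lemma sadd_right_solvable:
  assumes "a \<in> carrier B" "y \<in> carrier B"
  shows "\<exists>x\<in>carrier B. a \<boxplus> x = y"
proof
  have "a \<otimes> (inv a \<otimes> y) = y"
    using assms by (simp add: m_assoc[symmetric])
  then show "a \<boxplus> sb_lambda B a (inv a \<otimes> y) = y"
    using mult_eq_sadd_lambda[of a "inv a \<otimes> y"] assms by simp
qed (use assms in simp)

lemma sb_idem_closed: "e \<in> sb_idem B \<Longrightarrow> e \<in> carrier B"
  by (simp add: sb_idem_def)

lemma sb_idem_sadd_left:
  assumes "e \<in> sb_idem B" "b \<in> carrier B"
  shows "e \<boxplus> b = b"
proof -
  have e: "e \<in> carrier B" "e \<boxplus> e = e"
    using assms by (auto simp: sb_idem_def)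
  then have "e \<boxplus> (e \<boxplus> b) = e \<boxplus> b"
    using sadd_assoc[of e e b] assms by simp
  then show ?thesis
    using e assms sadd_left_cancel[of e "e \<boxplus> b" b] by simp
qed

lemma sb_lambda_idem:
  assumes "a \<in> carrier B" "e \<in> sb_idem B"
  shows "sb_lambda B a e \<in> sb_idem B"
  using sb_lambda_sadd[of a e e] assms by (simp add: sb_idem_def)

lemma proj_closed [simp]: "x \<in> carrier B \<Longrightarrow> proj x \<in> carrier B"
  by (simp add: proj_def)

lemma proj_in_grp [simp]: "x \<in> carrier B \<Longrightarrow> proj x \<in> sb_grp B"
  by (auto simp: proj_def sb_grp_def)

lemma proj_proj [simp]: "x \<in> carrier B \<Longrightarrow> proj (proj x) = proj x"
  by (simp add: proj_def sadd_assoc)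

lemma sb_grp_iff: "x \<in> sb_grp B \<longleftrightarrow> x \<in> carrier B \<and> proj x = x"
proof
  assume "x \<in> sb_grp B"
  then obtain b where b: "b \<in> carrier B" "x = proj b"
    by (auto simp: sb_grp_def proj_def)
  then show "x \<in> carrier B \<and> proj x = x" by simp
next
  assume "x \<in> carrier B \<and> proj x = x"
  then show "x \<in> sb_grp B" using proj_in_grp by metis
qed

lemma sb_grp_closed: "x \<in> sb_grp B \<Longrightarrow> x \<in> carrier B"
  by (simp add: sb_grp_iff)

lemma proj_grp: "x \<in> sb_grp B \<Longrightarrow> proj x = x"
  by (simp add: sb_grp_iff)

lemma proj_sadd_left:
  "x \<in> carrier B \<Longrightarrow> y \<in> carrier B \<Longrightarrow> proj x \<boxplus> y = x \<boxplus> y"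
  by (simp add: proj_def sadd_assoc)

lemma proj_sadd:
  "x \<in> carrier B \<Longrightarrow> y \<in> carrier B \<Longrightarrow> proj (x \<boxplus> y) = proj x \<boxplus> proj y"
  by (simp add: proj_def sadd_assoc)

lemma proj_idem: "e \<in> sb_idem B \<Longrightarrow> proj e = \<one>"
  by (simp add: proj_def sb_idem_sadd_left)

lemma one_idem: "\<one> \<in> sb_idem B"
  by (simp add: sb_idem_def)

lemma ex_idem_decomposition:
  assumes "x \<in> carrier B"
  shows "\<exists>e\<in>sb_idem B. proj x \<boxplus> e = x"
proof -
  obtain e where e: "e \<in> carrier B" "x \<boxplus> e = x"
    using sadd_right_solvable[OF assms assms] by blast
  have "x \<boxplus> (e \<boxplus> e) = x \<boxplus> e"
    using sadd_assoc[of x e e] e assms by simp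
  then have "e \<boxplus> e = e"
    using e assms sadd_left_cancel[of x "e \<boxplus> e" e] by simp
  then have "e \<in> sb_idem B"
    using e by (simp add: sb_idem_def)
  then show ?thesis
    using e assms by (intro bexI[of _ e]) (simp_all add: proj_sadd_left)
qed

lemma sb_grp_sadd_closed:
  assumes "x \<in> sb_grp B" "y \<in> sb_grp B"
  shows "x \<boxplus> y \<in> sb_grp B"
  using assms proj_sadd[of x y] proj_in_grp[of "x \<boxplus> y"]
  by (simp add: proj_grp sb_grp_closed)

lemma one_in_sb_grp: "\<one> \<in> sb_grp B"
  using proj_in_grp[of \<one>] by (simp add: proj_def)

lemma sb_add_group_simps:
  "carrier (sb_add_group B) = sb_grp B"
  "mult (sb_add_group B) = sadd B"
  "one (sb_add_group B) = \<one>"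
  by (simp_all add: sb_add_group_def)

lemma sb_add_group_is_group: "group (sb_add_group B)"
proof (rule groupI, unfold sb_add_group_simps)
  fix x assume "x \<in> sb_grp B"
  then have x: "x \<in> carrier B" "proj x = x"
    using sb_grp_iff by blast+
  \<comment> \<open>Right inverses exist by solvability; a right inverse \<open>y\<close> in \<open>G\<close> of \<open>x\<close> has a right inverse
    \<open>z\<close> itself, and \<open>z = 0 + z = x + y + z = x + 0 = x\<close>, so \<open>y\<close> is a left inverse.\<close>
  have right_inv: "\<exists>y\<in>sb_grp B. x \<boxplus> y = \<one>" if x: "x \<in> carrier B" for x
  proof -
    obtain y where y: "y \<in> carrier B" "x \<boxplus> y = \<one>"
      using sadd_right_solvable[OF x one_closed] by blast
    then have "x \<boxplus> proj y = \<one>"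
      using x sadd_assoc[of x y \<one>] by (simp add: proj_def)
    then show ?thesis using y proj_in_grp by blast
  qed
  obtain y where y: "y \<in> sb_grp B" "x \<boxplus> y = \<one>"
    using right_inv x by blast
  then obtain z where z: "z \<in> sb_grp B" "y \<boxplus> z = \<one>"
    using right_inv sb_grp_closed by blast
  have "z = (x \<boxplus> y) \<boxplus> z"
    using y z by (simp add: sb_grp_closed)
  also have "\<dots> = x \<boxplus> (y \<boxplus> z)"
    using x y z by (intro sadd_assoc) (simp_all add: sb_grp_closed)
  also have "\<dots> = x"
    using x z by (simp add: proj_def)
  finally have "y \<boxplus> x = \<one>"
    using z by simp
  then show "\<exists>y\<in>sb_grp B. y \<boxplus> x = \<one>"
    using y by (intro bexI[of _ y])
qed (simp_all add: sb_grp_sadd_closed one_in_sb_grp sadd_assoc sb_grp_closed)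

end

text \<open>The rewrites present the facts about the group \<open>(G, +)\<close> in terms of \<open>\<boxplus>\<close> and \<open>\<one>\<close>.\<close>

sublocale left_semi_brace \<subseteq> add: group "sb_add_group B"
  rewrites "carrier (sb_add_group B) = sb_grp B"
    and "mult (sb_add_group B) = sadd B"
    and "one (sb_add_group B) = \<one>"
  by (rule sb_add_group_is_group) (rule sb_add_group_simps)+

section \<open>The action of the multiplicative group\<close>

context left_semi_brace
begin

declare proj_grp [simp]

text \<open>The inverse in \<open>(G, +)\<close>, as opposed to \<open>inv\<close>, the inverse in \<open>(B, \<circ>)\<close>.\<close>

abbreviation neg :: "'a \<Rightarrow> 'a"
  where "neg x \<equiv> m_inv (sb_add_group B) x"

lemma act_in_grp [simp]: "a \<in> carrier B \<Longrightarrow> x \<in> carrier B \<Longrightarrow> act a x \<in> sb_grp B"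
  by (simp add: act_def)

lemma act_sadd:
  assumes "a \<in> carrier B" "x \<in> carrier B" "y \<in> carrier B"
  shows "act a (x \<boxplus> y) = act a x \<boxplus> act a y"
  using assms by (simp add: act_def sb_lambda_sadd proj_sadd)

lemma act_proj:
  assumes "a \<in> carrier B" "x \<in> carrier B"
  shows "act a (proj x) = proj (sb_lambda B a x)"
proof -
  have "act a (proj x) = proj (sb_lambda B a x) \<boxplus> proj (sb_lambda B a \<one>)"
    using assms by (simp add: act_def proj_def[of x] sb_lambda_sadd proj_sadd)
  also have "proj (sb_lambda B a \<one>) = \<one>"
    using assms by (intro proj_idem sb_lambda_idem one_idem)
  finally show ?thesis using assms by simp
qed

lemma act_mult:
  assumes "a \<in> carrier B" "b \<in> carrier B" "x \<in> carrier B"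
  shows "act (a \<otimes> b) x = act a (act b x)"
proof -
  have "act a (act b x) = proj (sb_lambda B a (sb_lambda B b x))"
    unfolding act_def[of b x] using assms by (simp add: act_proj)
  then show ?thesis
    using assms by (simp add: act_def sb_lambda_mult)
qed

lemma act_one [simp]: "x \<in> sb_grp B \<Longrightarrow> act \<one> x = x"
  by (simp add: act_def sb_grp_closed)

lemma act_hom: "a \<in> carrier B \<Longrightarrow> act a \<in> hom (sb_add_group B) (sb_add_group B)"
  by (auto simp: hom_def sb_add_group_simps sb_grp_closed act_sadd)

lemma act_group_hom:
  "a \<in> carrier B \<Longrightarrow> group_hom (sb_add_group B) (sb_add_group B) (act a)"
  by (simp add: group_hom_def group_hom_axioms_def sb_add_group_is_group act_hom)

lemma act_neg:
  assumes "a \<in> carrier B" "x \<in> sb_grp B"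
  shows "act a (neg x) = neg (act a x)"
  using group_hom.hom_inv[OF act_group_hom[OF assms(1)]] assms(2)
  by (simp add: sb_add_group_simps)

text \<open>The projection is a cocycle for the action.\<close>

lemma proj_mult:
  assumes "x \<in> carrier B" "y \<in> carrier B"
  shows "proj (x \<otimes> y) = proj x \<boxplus> act x (proj y)"
  using assms by (simp add: mult_eq_sadd_lambda proj_sadd act_proj)

lemma proj_inv:
  assumes "x \<in> carrier B"
  shows "proj (inv x) = neg (act (inv x) (proj x))"
proof -
  have "proj (inv x) \<boxplus> act (inv x) (proj x) = \<one>"
    using proj_mult[of "inv x" x] assms by (simp add: proj_def[of \<one>])
  then show ?thesis
    using add.inv_equality assms by (simp add: sb_grp_closed)
qed

lemma sb_lambda_inv:
  assumes "a \<in> carrier B"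
  shows "sb_lambda B a (inv a) = neg (proj a)"
proof (rule sadd_left_cancel)
  have "a \<boxplus> neg (proj a) = \<one>"
    using assms proj_sadd_left[of a "neg (proj a)"] by (simp add: sb_grp_closed)
  then show "a \<boxplus> sb_lambda B a (inv a) = a \<boxplus> neg (proj a)"
    using mult_eq_sadd_lambda[of a "inv a"] assms by simp
qed (use assms in \<open>simp_all add: sb_grp_closed\<close>)

lemma sb_dot_eq:
  assumes "a \<in> carrier B" "b \<in> carrier B"
  shows "sb_dot B a b = act a (proj b) \<boxplus> neg (proj b)"
proof -
  have c: "neg (proj a) \<in> carrier B" "neg (proj b) \<in> carrier B"
    using assms by (simp_all add: sb_grp_closed)
  have "neg (proj a) \<boxplus> (a \<boxplus> x) = x" if "x \<in> carrier B" for x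
    using that assms c sadd_assoc[of "neg (proj a)" "proj a" x]
    by (simp add: proj_sadd_left)
  then have "sb_dot B a b = sb_lambda B a b \<boxplus> neg (proj b)"
    using assms c by (simp add: sb_dot_def sb_lambda_inv mult_eq_sadd_lambda)
  then show ?thesis
    using assms c by (simp add: act_proj proj_sadd_left)
qed

section \<open>A criterion for ideals\<close>

lemma sb_set_add_idem_eq:
  assumes "H \<subseteq> sb_grp B"
  shows "sb_set_add B H (sb_idem B) = {x \<in> carrier B. proj x \<in> H}"
proof (intro equalityI subsetI)
  fix x assume "x \<in> sb_set_add B H (sb_idem B)"
  then obtain h e where x: "h \<in> H" "e \<in> sb_idem B" "x = h \<boxplus> e"
    by (auto simp: sb_set_add_def)
  have h: "h \<in> sb_grp B" using x assms by auto
  have "proj x = h"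
    using x h by (simp add: proj_sadd sb_grp_closed sb_idem_closed proj_idem)
  then show "x \<in> {x \<in> carrier B. proj x \<in> H}"
    using x h by (simp add: sb_grp_closed sb_idem_closed)
next
  fix x assume "x \<in> {x \<in> carrier B. proj x \<in> H}"
  then show "x \<in> sb_set_add B H (sb_idem B)"
    using ex_idem_decomposition[of x] by (force simp: sb_set_add_def)
qed

text \<open>
  The third hypothesis says that \<open>\<pi>\<^sup>-\<^sup>1(H)\<close> acts trivially on \<open>G/H\<close>. It is needed only for the
  normality of \<open>\<pi>\<^sup>-\<^sup>1(H)\<close> in \<open>(B, \<circ>)\<close>.
\<close>

lemma sb_ideal_vimage_proj:
  assumes normal: "H \<lhd> sb_add_group B"
    and act: "\<And>b h. b \<in> carrier B \<Longrightarrow> h \<in> H \<Longrightarrow> act b h \<in> H"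
    and diff: "\<And>x g. x \<in> carrier B \<Longrightarrow> proj x \<in> H \<Longrightarrow> g \<in> sb_grp B \<Longrightarrow> act x g \<boxplus> neg g \<in> H"
  shows "sb_ideal {x \<in> carrier B. proj x \<in> H} B"
    (is "sb_ideal ?J B")
proof -
  have subgroup: "subgroup H (sb_add_group B)"
    using normal by (rule normal_imp_subgroup)
  have H_sub: "H \<subseteq> sb_grp B"
    and H_add: "\<And>x y. x \<in> H \<Longrightarrow> y \<in> H \<Longrightarrow> x \<boxplus> y \<in> H"
    and H_neg: "\<And>x. x \<in> H \<Longrightarrow> neg x \<in> H"
    and H_one: "\<one> \<in> H"
    using subgroup.subset[OF subgroup] subgroup.m_closed[OF subgroup]
      subgroup.m_inv_closed[OF subgroup] subgroup.one_closed[OF subgroup]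
    by (simp_all add: sb_add_group_simps)
  have H_conj: "g \<boxplus> h \<boxplus> neg g \<in> H" and H_conj': "neg g \<boxplus> h \<boxplus> g \<in> H"
    if "g \<in> sb_grp B" "h \<in> H" for g h
    using normal.inv_op_closed2[OF normal, of g h] normal.inv_op_closed1[OF normal, of g h] that
    by (simp_all add: sb_add_group_simps)
  have J_mult: "x \<otimes> y \<in> ?J" if "x \<in> ?J" "y \<in> ?J" for x y
    using that by (simp add: proj_mult H_add act)
  have J_inv: "inv x \<in> ?J" if "x \<in> ?J" for x
    using that by (simp add: proj_inv H_neg act)
  have J_conj: "b \<otimes> x \<otimes> inv b \<in> ?J" if b: "b \<in> carrier B" and "x \<in> ?J" for b x
  proof -
    define y where "y = b \<otimes> x \<otimes> inv b"
    define g where "g = proj b"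
    define g' where "g' = act (inv b) g"
    have x: "x \<in> carrier B" "proj x \<in> H" using that by auto
    have y: "y \<in> carrier B" using b x by (simp add: y_def)
    have g: "g \<in> sb_grp B" "g' \<in> sb_grp B" using b by (simp_all add: g_def g'_def)
    \<comment> \<open>The element \<open>y\<close> moves \<open>g\<close> only by an element of \<open>H\<close>, because \<open>x\<close> moves \<open>g'\<close> only by one.\<close>
    have "act b g' = g"
      using b g act_mult[of b "inv b" g] by (simp add: g'_def sb_grp_closed)
    then have "act y g \<boxplus> neg g = act b (act x g' \<boxplus> neg g')"
      using b x g by (simp add: y_def g'_def act_mult act_sadd act_neg sb_grp_closed)
    also have "\<dots> \<in> H" using act diff b x g by simp
    finally have moved: "act y g \<boxplus> neg g \<in> H" .
    \<comment> \<open>Apply \<open>\<pi>\<close> to \<open>y \<circ> b = b \<circ> x\<close>.\<close>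
    have "y \<otimes> b = b \<otimes> x" using b x by (simp add: y_def m_assoc)
    then have eq: "proj y \<boxplus> act y g = g \<boxplus> act b (proj x)"
      using proj_mult[of y b] proj_mult[of b x] b x y by (simp add: g_def)
    have "proj y \<boxplus> act y g \<boxplus> neg g = proj y \<boxplus> (act y g \<boxplus> neg g)"
      using y g by (simp add: add.m_assoc sb_grp_closed)
    then have "proj y = (g \<boxplus> act b (proj x) \<boxplus> neg g) \<boxplus> neg (act y g \<boxplus> neg g)"
      using y g b x add.inv_solve_right[of "proj y" "g \<boxplus> act b (proj x) \<boxplus> neg g" "act y g \<boxplus> neg g"]
      by (simp add: eq sb_grp_closed)
    also have "\<dots> \<in> H"
      by (rule H_add[OF H_conj[OF g(1) act[OF b x(2)]] H_neg[OF moved]])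
    finally show ?thesis using y by (simp add: y_def)
  qed
  have "subgroup ?J B"
    using J_mult J_inv H_one by (intro subgroupI) (auto simp: proj_def[of \<one>])
  then have J_normal: "?J \<lhd> B"
    using J_conj by (simp add: normal_inv_iff)
  have J_grp: "?J \<inter> sb_grp B = H"
    using H_sub by (auto simp: sb_grp_closed subset_eq)
  have J_rho: "sb_rho B b n \<in> ?J" if b: "b \<in> carrier B" and "n \<in> H" for b n
  proof -
    define c where "c = inv n \<boxplus> b"
    have n: "n \<in> carrier B" "proj n \<in> H"
      using that H_sub by (auto simp: sb_grp_closed subset_eq)
    have c: "c \<in> carrier B" using b n by (simp add: c_def)
    have proj_inv_n: "proj (inv n) \<in> H" "proj (inv n) \<in> sb_grp B"
      using J_inv n by simp_all
    have "neg (proj c) \<boxplus> proj b = neg (proj b) \<boxplus> neg (proj (inv n)) \<boxplus> proj b"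
      using b n by (simp add: c_def proj_sadd add.inv_mult_group)
    also have "\<dots> \<in> H"
      using b proj_inv_n by (intro H_conj' H_neg) auto
    finally have "act (inv c) (neg (proj c) \<boxplus> proj b) \<in> H"
      using act c by simp
    then have "proj (inv c \<otimes> b) \<in> H"
      using b c by (simp add: proj_mult proj_inv act_sadd act_neg sb_grp_closed)
    then show ?thesis
      using b c by (simp add: sb_rho_def c_def)
  qed
  have J_lambda: "sb_lambda B g e \<in> ?J" if "g \<in> sb_grp B" "e \<in> sb_idem B" for g e
    using that sb_lambda_idem[of g e] H_one
    by (simp add: sb_grp_closed sb_idem_closed proj_idem)
  show ?thesis
    unfolding sb_ideal_def J_grp
    using J_normal normal J_rho J_lambda by (auto simp: proj_sadd H_add)
qed

section \<open>The right series\<close>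

lemma sb_dot_closed: "a \<in> carrier B \<Longrightarrow> b \<in> carrier B \<Longrightarrow> sb_dot B a b \<in> sb_grp B"
  by (simp add: sb_dot_eq sb_grp_closed)

lemma sb_dots_subset:
  "I \<subseteq> carrier B \<Longrightarrow> {sb_dot B x y | x y. x \<in> I \<and> y \<in> carrier B} \<subseteq> sb_grp B"
  by (auto simp: subset_eq sb_dot_closed)

lemma sb_set_dot_subgroup:
  "I \<subseteq> carrier B \<Longrightarrow> subgroup (sb_set_dot B I (carrier B)) (sb_add_group B)"
  unfolding sb_set_dot_def
  by (rule group.generate_is_subgroup[OF sb_add_group_is_group])
    (simp add: sb_add_group_simps sb_dots_subset)

text \<open>
  By \<open>sb_dot_eq\<close>, the product \<open>a \<cdot> b\<close> depends on \<open>b\<close> only through \<open>\<pi>(b)\<close>, so that the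
  elements \<open>\<mu>\<^sub>a(g) - g\<close> with \<open>g \<in> G\<close> are all the generators of \<open>I \<cdot> B\<close>.
\<close>

lemma act_diff_in_set_dot:
  assumes "I \<subseteq> carrier B" "a \<in> I" "g \<in> sb_grp B"
  shows "act a g \<boxplus> neg g \<in> sb_set_dot B I (carrier B)"
proof -
  have "sb_dot B a g \<in> sb_set_dot B I (carrier B)"
    unfolding sb_set_dot_def using assms by (blast intro: generate.incl sb_grp_closed)
  then show ?thesis
    using assms by (simp add: sb_dot_eq sb_grp_closed subset_eq)
qed

text \<open>A subgroup \<open>I \<cdot> B\<close> is stable under an endomorphism of \<open>G\<close> that maps its generators into it.\<close>

lemma hom_image_set_dot:
  assumes I: "I \<subseteq> carrier B"
    and f: "f \<in> hom (sb_add_group B) (sb_add_group B)"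
    and gen: "\<And>a g. a \<in> I \<Longrightarrow> g \<in> sb_grp B \<Longrightarrow>
                f (act a g \<boxplus> neg g) \<in> sb_set_dot B I (carrier B)"
    and h: "h \<in> sb_set_dot B I (carrier B)"
  shows "f h \<in> sb_set_dot B I (carrier B)"
proof -
  define S where "S = {sb_dot B x y | x y. x \<in> I \<and> y \<in> carrier B}"
  have S: "S \<subseteq> carrier (sb_add_group B)"
    using sb_dots_subset[OF I] by (simp add: S_def sb_add_group_simps)
  have hom: "group_hom (sb_add_group B) (sb_add_group B) f"
    by (simp add: group_hom_def group_hom_axioms_def sb_add_group_is_group f)
  have "f ` S \<subseteq> sb_set_dot B I (carrier B)"
    using I gen by (auto simp: S_def sb_dot_eq subset_eq)
  then have "generate (sb_add_group B) (f ` S) \<subseteq> sb_set_dot B I (carrier B)"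
    by (rule group.generate_subgroup_incl[OF sb_add_group_is_group _ sb_set_dot_subgroup[OF I]])
  then show ?thesis
    using group_hom.generate_img[OF hom S] h by (auto simp: sb_set_dot_def S_def)
qed

lemma sb_set_dot_normal:
  assumes I: "I \<subseteq> carrier B"
  shows "sb_set_dot B I (carrier B) \<lhd> sb_add_group B"
proof -
  let ?H = "sb_set_dot B I (carrier B)"
  have sub: "subgroup ?H (sb_add_group B)"
    by (rule sb_set_dot_subgroup[OF I])
  have "g \<boxplus> h \<boxplus> neg g \<in> ?H" if g: "g \<in> sb_grp B" and h: "h \<in> ?H" for g h
  proof (rule hom_image_set_dot[OF I _ _ h, where f = "\<lambda>x. g \<boxplus> x \<boxplus> neg g"])
    have "g \<boxplus> (x \<boxplus> y) \<boxplus> neg g = (g \<boxplus> x \<boxplus> neg g) \<boxplus> (g \<boxplus> y \<boxplus> neg g)"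
      if "x \<in> sb_grp B" "y \<in> sb_grp B" for x y
    proof -
      have "neg g \<boxplus> (g \<boxplus> (y \<boxplus> neg g)) = y \<boxplus> neg g"
        using g that by (simp add: add.m_assoc[symmetric])
      then show ?thesis
        using g that by (simp add: add.m_assoc)
    qed
    then show "(\<lambda>x. g \<boxplus> x \<boxplus> neg g) \<in> hom (sb_add_group B) (sb_add_group B)"
      using g by (auto simp: hom_def sb_add_group_simps)
  next
    fix a k assume a: "a \<in> I" and k: "k \<in> sb_grp B"
    have aB: "a \<in> carrier B" using a I by auto
    have c: "act a g \<in> sb_grp B" "act a k \<in> sb_grp B"
      using aB g k by (simp_all add: sb_grp_closed)
    have "neg (act a g \<boxplus> neg g) \<boxplus> (act a (g \<boxplus> k) \<boxplus> neg (g \<boxplus> k))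
        = g \<boxplus> (neg (act a g) \<boxplus> (act a g \<boxplus> (act a k \<boxplus> (neg k \<boxplus> neg g))))"
      using aB g k c by (simp add: act_sadd sb_grp_closed add.inv_mult_group add.m_assoc)
    also have "neg (act a g) \<boxplus> (act a g \<boxplus> (act a k \<boxplus> (neg k \<boxplus> neg g)))
        = act a k \<boxplus> (neg k \<boxplus> neg g)"
      using g k c by (simp add: add.m_assoc[symmetric])
    finally have "g \<boxplus> (act a k \<boxplus> neg k) \<boxplus> neg g
        = neg (act a g \<boxplus> neg g) \<boxplus> (act a (g \<boxplus> k) \<boxplus> neg (g \<boxplus> k))"
      using g k c by (simp add: add.m_assoc)
    also have "\<dots> \<in> ?H"
      using act_diff_in_set_dot[OF I a] g k
        subgroup.m_inv_closed[OF sub] subgroup.m_closed[OF sub]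
      by (simp add: sb_add_group_simps)
    finally show "g \<boxplus> (act a k \<boxplus> neg k) \<boxplus> neg g \<in> ?H" .
  qed
  then show ?thesis
    using sub by (simp add: add.normal_inv_iff sb_add_group_simps)
qed

lemma act_set_dot:
  assumes I: "I \<lhd> B" and b: "b \<in> carrier B" and h: "h \<in> sb_set_dot B I (carrier B)"
  shows "act b h \<in> sb_set_dot B I (carrier B)"
proof -
  have I_sub: "I \<subseteq> carrier B"
    using I by (simp add: normal_imp_subgroup subgroup.subset)
  show ?thesis
  proof (rule hom_image_set_dot[OF I_sub act_hom[OF b] _ h])
    fix a g assume a: "a \<in> I" and g: "g \<in> sb_grp B"
    have aB: "a \<in> carrier B" using a I_sub by auto
    define a' where "a' = b \<otimes> a \<otimes> inv b"
    have a': "a' \<in> I"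
      unfolding a'_def using normal.inv_op_closed2[OF I b a] .
    have "a' \<otimes> b = b \<otimes> a"
      using aB b by (simp add: a'_def m_assoc)
    then have "act a' (act b g) = act b (act a g)"
      using act_mult[of a' b g] act_mult[of b a g] aB b a' I_sub g
      by (auto simp: sb_grp_closed)
    then have "act b (act a g \<boxplus> neg g) = act a' (act b g) \<boxplus> neg (act b g)"
      using aB b g by (simp add: act_sadd act_neg sb_grp_closed)
    also have "\<dots> \<in> sb_set_dot B I (carrier B)"
      using act_diff_in_set_dot[OF I_sub a'] b g by (simp add: sb_grp_closed)
    finally show "act b (act a g \<boxplus> neg g) \<in> sb_set_dot B I (carrier B)" .
  qed
qed

lemma set_dot_sadd_idem_eq:
  assumes "I \<subseteq> carrier B"
  shows "sb_set_add B (sb_set_dot B I (carrier B)) (sb_idem B)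
    = {x \<in> carrier B. proj x \<in> sb_set_dot B I (carrier B)}"
  using subgroup.subset[OF sb_set_dot_subgroup[OF assms]]
  by (intro sb_set_add_idem_eq) (simp add: sb_add_group_simps)

lemma right_series_subset_carrier: "right_series B (Suc n) \<subseteq> carrier B"
proof (induction n)
  case (Suc n)
  then show ?case by (auto simp: set_dot_sadd_idem_eq)
qed simp

lemma sb_set_dot_mono:
  assumes "X \<subseteq> Y" shows "sb_set_dot B X Z \<subseteq> sb_set_dot B Y Z"
  unfolding sb_set_dot_def
  by (rule group.mono_generate[OF sb_add_group_is_group]) (use assms in blast)

lemma right_series_decreasing: "right_series B (Suc (Suc n)) \<subseteq> right_series B (Suc n)"
proof (induction n)
  case 0
  then show ?case using right_series_subset_carrier[of "Suc 0"] by simp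
next
  case (Suc n)
  show ?case
    using sb_set_dot_mono[OF Suc, of "carrier B"]
    by (subst (1 2) right_series.simps(3)) (auto simp: sb_set_add_def)
qed

lemma sb_ideal_carrier: "sb_ideal (carrier B) B"
proof -
  have "sb_ideal {x \<in> carrier B. proj x \<in> sb_grp B} B"
  proof (rule sb_ideal_vimage_proj)
    show "sb_grp B \<lhd> sb_add_group B"
      using group.normal_inv_iff[OF sb_add_group_is_group] group.subgroup_self[OF sb_add_group_is_group]
      by (simp add: sb_add_group_simps)
  qed (simp_all add: sb_grp_closed)
  also have "{x \<in> carrier B. proj x \<in> sb_grp B} = carrier B" by auto
  finally show ?thesis .
qed

lemma sb_ideal_right_series: "sb_ideal (right_series B (Suc n)) B"
proof (induction n)
  case 0
  then show ?case by (simp add: sb_ideal_carrier)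
next
  case (Suc n)
  define I where "I = right_series B (Suc n)"
  have I: "I \<subseteq> carrier B" "I \<lhd> B"
    using Suc by (simp_all add: I_def sb_ideal_def)
  have eq: "right_series B (Suc (Suc n))
      = {x \<in> carrier B. proj x \<in> sb_set_dot B I (carrier B)}"
    using set_dot_sadd_idem_eq[OF I(1)] by (simp add: I_def)
  show ?case
    unfolding eq
  proof (rule sb_ideal_vimage_proj)
    fix x g
    assume x: "x \<in> carrier B" "proj x \<in> sb_set_dot B I (carrier B)" and g: "g \<in> sb_grp B"
    have "x \<in> I"
      using right_series_decreasing[of n] x unfolding eq by (auto simp: I_def)
    then show "act x g \<boxplus> neg g \<in> sb_set_dot B I (carrier B)"
      by (rule act_diff_in_set_dot[OF I(1) _ g])
  qed (use I sb_set_dot_normal act_set_dot in auto)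
qed

end

theorem proposition19:
  fixes B :: "('a, 'b) semi_brace_scheme" and n :: nat
  assumes "left_semi_brace B" and "n \<ge> 1"
  shows "sb_ideal (right_series B n) B"
  using left_semi_brace.sb_ideal_right_series[OF assms(1), of "n - 1"] assms(2) by simp

end
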